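(* Let $G$ be a topological group. If $G$ admits a non-trivial continuous group homomorphism to the multiplicative group $\mathbb{R}_{>0}$, then $G$ has no universal irreducible conic representation.
   Context: Topological linear spaces (real or complex) are Hausdorff. A cone $V$ is a subset of a topological linear space with point-separating continuous dual such that $ax+by\in V$ for all $x,y\in V$, $a,b\ge 0$. A section of $V$ is a set $L^{-1}(1)$, where $L:V\to\mathbb{R}_{\ge 0}$ is continuous, preserves non-negative linear combinations, and is strictly positive on $V\setminus\{0\}$. A conic representation $(V,\tau)$ of $G$ consists of a non-zero cone $V$ admitting a compact section and a continuous action $\tau:G\times V\to V$ such that each $\tau_g$ preserves non-negative linear combinations. It is irreducible if $V$ has no closed non-zero $G$-invariant sub-cone other than $V$. A homomorphism of conic representations is a continuous $G$-equivariant map that preserves non-negative linear combinations and does not vanish at any non-zero point. A universal irreducible conic representation of $G$ is an irreducible conic representation admitting a homomorphism to every irreducible conic representation of $G$. *)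

theory Defs
  imports "HOL-Analysis.Analysis" "HOL-Algebra.Group"
begin

section \<open>Hausdorff topological linear spaces\<close>

text \<open>
  Scalars are real. A complex topological linear space is covered through its underlying real
  space: cones, sections and conic representations only involve non-negative real scalars, and the
  complex continuous dual separates points iff the real one does (take real parts, and conversely
  \<open>x \<mapsto> f x - \<i> f (\<i> x)\<close>).
\<close>

class real_tvs = real_vector + topological_ab_group_add + t2_space +
  assumes tendsto_scaleR_Pair:
    "LIM x (nhds a \<times>\<^sub>F nhds b). fst x *\<^sub>R snd x :> nhds (a *\<^sub>R b)"

instance real_normed_vector \<subseteq> real_tvs
proof
  fix a :: real and b :: 'a
  show "LIM x (nhds a \<times>\<^sub>F nhds b). fst x *\<^sub>R snd x :> nhds (a *\<^sub>R b)"
    by (intro tendsto_scaleR filterlim_fst filterlim_snd)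
qed

definition continuous_functional :: "('v::real_tvs \<Rightarrow> real) \<Rightarrow> bool" where
  "continuous_functional f \<longleftrightarrow> linear f \<and> continuous_on UNIV f"

definition separating_dual :: "'v::real_tvs itself \<Rightarrow> bool" where
  "separating_dual _ \<longleftrightarrow> (\<forall>x::'v. x \<noteq> 0 \<longrightarrow> (\<exists>f. continuous_functional f \<and> f x \<noteq> 0))"

section \<open>Cones and conic representations\<close>

definition linear_cone :: "'v::real_tvs set \<Rightarrow> bool" where
  "linear_cone V \<longleftrightarrow> separating_dual TYPE('v) \<and>
     (\<forall>x\<in>V. \<forall>y\<in>V. \<forall>a\<ge>0. \<forall>b\<ge>0. a *\<^sub>R x + b *\<^sub>R y \<in> V)"

definition preserves_combinations ::
    "'v::real_vector set \<Rightarrow> ('v \<Rightarrow> 'w::real_vector) \<Rightarrow> bool" where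
  "preserves_combinations V f \<longleftrightarrow>
     (\<forall>x\<in>V. \<forall>y\<in>V. \<forall>a\<ge>0. \<forall>b\<ge>0. f (a *\<^sub>R x + b *\<^sub>R y) = a *\<^sub>R f x + b *\<^sub>R f y)"

definition section_of :: "'v::real_tvs set \<Rightarrow> 'v set \<Rightarrow> bool" where
  "section_of V S \<longleftrightarrow>
     (\<exists>L::'v \<Rightarrow> real. continuous_on V L \<and> preserves_combinations V L \<and>
        (\<forall>x\<in>V. 0 \<le> L x) \<and> (\<forall>x\<in>V - {0}. 0 < L x) \<and> S = {x\<in>V. L x = 1})"

definition topological_group :: "('g, 'm) monoid_scheme \<Rightarrow> 'g topology \<Rightarrow> bool" where
  "topological_group G T \<longleftrightarrow> group G \<and> topspace T = carrier G \<and>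
     continuous_map (prod_topology T T) T (\<lambda>(g, h). g \<otimes>\<^bsub>G\<^esub> h) \<and>
     continuous_map T T (\<lambda>g. inv\<^bsub>G\<^esub> g)"

definition positive_reals :: "real monoid" where
  "positive_reals = \<lparr>carrier = {0<..}, mult = (*), one = 1\<rparr>"

definition conic_representation ::
    "('g, 'm) monoid_scheme \<Rightarrow> 'g topology \<Rightarrow> 'v::real_tvs set \<Rightarrow> ('g \<Rightarrow> 'v \<Rightarrow> 'v) \<Rightarrow> bool" where
  "conic_representation G T V \<tau> \<longleftrightarrow>
     linear_cone V \<and> (\<exists>x\<in>V. x \<noteq> 0) \<and> (\<exists>S. section_of V S \<and> compact S) \<and>
     continuous_map (prod_topology T (top_of_set V)) (top_of_set V) (\<lambda>(g, x). \<tau> g x) \<and>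
     (\<forall>x\<in>V. \<tau> \<one>\<^bsub>G\<^esub> x = x) \<and>
     (\<forall>g\<in>carrier G. \<forall>h\<in>carrier G. \<forall>x\<in>V. \<tau> (g \<otimes>\<^bsub>G\<^esub> h) x = \<tau> g (\<tau> h x)) \<and>
     (\<forall>g\<in>carrier G. preserves_combinations V (\<tau> g))"

definition irreducible_conic_representation ::
    "('g, 'm) monoid_scheme \<Rightarrow> 'g topology \<Rightarrow> 'v::real_tvs set \<Rightarrow> ('g \<Rightarrow> 'v \<Rightarrow> 'v) \<Rightarrow> bool" where
  "irreducible_conic_representation G T V \<tau> \<longleftrightarrow>
     conic_representation G T V \<tau> \<and>
     (\<forall>W. W \<subseteq> V \<and> linear_cone W \<and> closedin (top_of_set V) W \<and> (\<exists>x\<in>W. x \<noteq> 0) \<and>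
          (\<forall>g\<in>carrier G. \<tau> g ` W \<subseteq> W) \<longrightarrow> W = V)"

definition conic_homomorphism ::
    "('g, 'm) monoid_scheme \<Rightarrow> 'v::real_tvs set \<Rightarrow> ('g \<Rightarrow> 'v \<Rightarrow> 'v) \<Rightarrow>
     'w::real_tvs set \<Rightarrow> ('g \<Rightarrow> 'w \<Rightarrow> 'w) \<Rightarrow> ('v \<Rightarrow> 'w) \<Rightarrow> bool" where
  "conic_homomorphism G V \<tau> W \<sigma> f \<longleftrightarrow>
     f \<in> V \<rightarrow> W \<and> continuous_on V f \<and>
     (\<forall>g\<in>carrier G. \<forall>x\<in>V. f (\<tau> g x) = \<sigma> g (f x)) \<and>
     preserves_combinations V f \<and> (\<forall>x\<in>V. x \<noteq> 0 \<longrightarrow> f x \<noteq> 0)"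

section \<open>The topological linear space of all real families on an index type\<close>

text \<open>
  A copy of \<open>'i \<Rightarrow> real\<close> with pointwise operations and the product topology. The function type
  itself cannot be used: the library declares it Hausdorff only for countable index types.
\<close>

typedef 'i real_family = "UNIV :: ('i \<Rightarrow> real) set"
  morphisms coord Family by simp

lemmas coord_Family [simp] = Family_inverse[OF UNIV_I]

lemma real_family_eqI: "(\<And>i. coord x i = coord y i) \<Longrightarrow> x = y"
  by (metis coord_inject ext)

instantiation real_family :: (type) real_vector
begin

definition "0 = Family (\<lambda>i. 0)"
definition "x + y = Family (\<lambda>i. coord x i + coord y i)"
definition "x - y = Family (\<lambda>i. coord x i - coord y i)"
definition "- x = Family (\<lambda>i. - coord x i)"
definition "a *\<^sub>R x = Family (\<lambda>i. a * coord x i)"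

lemma coord_simps [simp]:
  "coord 0 i = 0"
  "coord (x + y) i = coord x i + coord y i"
  "coord (x - y) i = coord x i - coord y i"
  "coord (- x) i = - coord x i"
  "coord (a *\<^sub>R x) i = a * coord x i"
  by (simp_all add: zero_real_family_def plus_real_family_def minus_real_family_def
      uminus_real_family_def scaleR_real_family_def)

instance
  by standard (auto intro!: real_family_eqI simp: algebra_simps)

end

instantiation real_family :: (type) topological_space
begin

definition open_real_family :: "'a real_family set \<Rightarrow> bool" where
  "open_real_family U \<longleftrightarrow> open (Family -` U)"

instance
  by standard (auto simp: open_real_family_def vimage_Union)

end

lemma continuous_on_Family: "continuous_on UNIV Family"
  by (simp add: continuous_on_open_vimage open_real_family_def)

lemma continuous_on_coord: "continuous_on UNIV coord"
  by (simp add: continuous_on_open_vimage open_real_family_def vimage_comp o_def)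

lemma tendsto_real_family:
  "(f \<longlongrightarrow> l) F \<longleftrightarrow> (\<forall>i. ((\<lambda>x. coord (f x) i) \<longlongrightarrow> coord l i) F)"
proof -
  have "(f \<longlongrightarrow> l) F \<longleftrightarrow> ((\<lambda>x. coord (f x)) \<longlongrightarrow> coord l) F"
  proof
    assume "(f \<longlongrightarrow> l) F"
    with continuous_on_coord show "((\<lambda>x. coord (f x)) \<longlongrightarrow> coord l) F"
      by (rule continuous_on_tendsto_compose) auto
  next
    assume "((\<lambda>x. coord (f x)) \<longlongrightarrow> coord l) F"
    with continuous_on_Family have "((\<lambda>x. Family (coord (f x))) \<longlongrightarrow> Family (coord l)) F"
      by (rule continuous_on_tendsto_compose) auto
    then show "(f \<longlongrightarrow> l) F" by (simp add: coord_inverse)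
  qed
  also have "\<dots> \<longleftrightarrow> limitin (product_topology (\<lambda>i. euclidean) UNIV) (\<lambda>x. coord (f x)) (coord l) F"
    by (simp add: euclidean_product_topology)
  also have "\<dots> \<longleftrightarrow> (\<forall>i. ((\<lambda>x. coord (f x) i) \<longlongrightarrow> coord l i) F)"
    by (simp add: limitin_componentwise)
  finally show ?thesis .
qed

lemma continuous_on_real_family:
  "continuous_on S f \<longleftrightarrow> (\<forall>i. continuous_on S (\<lambda>x. coord (f x) i))"
  by (auto simp: continuous_on_def tendsto_real_family)

lemma continuous_on_coord_nth: "continuous_on UNIV (\<lambda>x. coord x i)"
  using continuous_on_id[of "UNIV :: 'a real_family set"] unfolding continuous_on_real_family by simp

instance real_family :: (type) real_tvs
proof
  fix a b :: "'a real_family" and c :: real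
  have fst: "((\<lambda>x. coord (fst x) i) \<longlongrightarrow> coord u i) (nhds u \<times>\<^sub>F nhds w)"
    and snd: "((\<lambda>x. coord (snd x) i) \<longlongrightarrow> coord u i) (nhds z \<times>\<^sub>F nhds u)"
    for u w :: "'a real_family" and i and z :: "'z::topological_space"
    using filterlim_fst[of "nhds u" "nhds w"] filterlim_snd[of "nhds u" "nhds z"]
    by (simp_all add: tendsto_real_family)
  show "LIM x (nhds a \<times>\<^sub>F nhds b). fst x + snd x :> nhds (a + b)"
    unfolding tendsto_real_family by (auto intro!: tendsto_add fst snd)
  have "((\<lambda>x. x) \<longlongrightarrow> a) (nhds a)" by (rule filterlim_ident)
  then show "(uminus \<longlongrightarrow> - a) (nhds a)"
    unfolding tendsto_real_family by (auto intro!: tendsto_minus)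
  show "LIM x (nhds c \<times>\<^sub>F nhds b). fst x *\<^sub>R snd x :> nhds (c *\<^sub>R b)"
    unfolding tendsto_real_family by (auto intro!: tendsto_mult filterlim_fst snd)
next
  fix f g :: "'a real_family"
  assume "f \<noteq> g"
  then obtain i where "coord f i \<noteq> coord g i" by (metis real_family_eqI)
  then obtain A B where AB: "open A" "open B" "coord f i \<in> A" "coord g i \<in> B" "A \<inter> B = {}"
    using hausdorff[of "coord f i" "coord g i"] by metis
  have "open ((\<lambda>h::'a real_family. coord h i) -` C)" if "open C" for C
    using that continuous_on_coord_nth by (rule open_vimage)
  with AB show "\<exists>U V. open U \<and> open V \<and> f \<in> U \<and> g \<in> V \<and> U \<inter> V = {}"
    by (intro exI[of _ "(\<lambda>h. coord h i) -` A"] exI[of _ "(\<lambda>h. coord h i) -` B"]) auto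
qed

lemma separating_dual_real_family: "separating_dual TYPE('i real_family)"
  unfolding separating_dual_def
proof (intro allI impI)
  fix x :: "'i real_family"
  assume "x \<noteq> 0"
  then obtain i where "coord x i \<noteq> 0" by (metis real_family_eqI coord_simps(1))
  moreover have "continuous_functional (\<lambda>h::'i real_family. coord h i)"
    by (auto simp: continuous_functional_def linear_iff continuous_on_coord_nth)
  ultimately show "\<exists>f. continuous_functional f \<and> f x \<noteq> 0" by blast
qed

section \<open>Universal irreducible conic representations\<close>

text \<open>
  A formula cannot quantify over all topological linear spaces, so the target representations range
  over the cones of the single space \<open>('g \<Rightarrow> real) real_family\<close>. This loses nothing: by
  \<open>irreducible_conic_representation_copy\<close> below, every irreducible conic representation of a
  topological group with elements in \<open>'g\<close>, in any space whatsoever, is isomorphic to one there,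
  and \<open>universal_irreducible_conic_representation_hom\<close> states the resulting universal property
  with the target in an arbitrary space.
\<close>

definition universal_irreducible_conic_representation ::
    "('g, 'm) monoid_scheme \<Rightarrow> 'g topology \<Rightarrow> 'v::real_tvs set \<Rightarrow> ('g \<Rightarrow> 'v \<Rightarrow> 'v) \<Rightarrow> bool" where
  "universal_irreducible_conic_representation G T V \<tau> \<longleftrightarrow>
     irreducible_conic_representation G T V \<tau> \<and>
     (\<forall>(W :: ('g \<Rightarrow> real) real_family set) \<sigma>.
        irreducible_conic_representation G T W \<sigma> \<longrightarrow> (\<exists>f. conic_homomorphism G V \<tau> W \<sigma> f))"

lemma conic_homomorphism_comp:
  assumes "conic_homomorphism G V \<tau> W \<sigma> f" "conic_homomorphism G W \<sigma> U \<rho> h"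
  shows "conic_homomorphism G V \<tau> U \<rho> (h \<circ> f)"
proof -
  have "continuous_on V (h \<circ> f)"
    using assms unfolding conic_homomorphism_def o_def
    by (intro continuous_on_compose2[of W h V f]) (auto simp: Pi_iff)
  then show ?thesis
    using assms unfolding conic_homomorphism_def preserves_combinations_def
    by (auto simp: Pi_iff)
qed

lemma continuous_on_scaleR_tvs:
  fixes f :: "'a::topological_space \<Rightarrow> real" and h :: "'a \<Rightarrow> 'v::real_tvs"
  assumes "continuous_on S f" "continuous_on S h"
  shows "continuous_on S (\<lambda>x. f x *\<^sub>R h x)"
  unfolding continuous_on_def
proof
  fix x assume "x \<in> S"
  with assms have "((\<lambda>x. (f x, h x)) \<longlongrightarrow> (f x, h x)) (at x within S)"
    by (auto simp: continuous_on_def intro: tendsto_Pair)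
  then show "((\<lambda>x. f x *\<^sub>R h x) \<longlongrightarrow> f x *\<^sub>R h x) (at x within S)"
    using filterlim_compose[OF tendsto_scaleR_Pair[of "f x" "h x"]]
    by (fastforce simp: nhds_prod)
qed

lemma preserves_combinations_scaleR:
  assumes "preserves_combinations V f" "x \<in> V" "a \<ge> 0"
  shows "f (a *\<^sub>R x) = a *\<^sub>R f x"
  using assms unfolding preserves_combinations_def
  by (metis add.right_neutral order_refl scaleR_zero_left)

lemma linear_cone_scaleR:
  assumes "linear_cone V" "x \<in> V" "a \<ge> 0"
  shows "a *\<^sub>R x \<in> V"
  using assms unfolding linear_cone_def
  by (metis add.right_neutral order_refl scaleR_zero_left)

lemma irreducible_conic_representation_transport:
  fixes V :: "'v::real_tvs set" and V' :: "'w::real_tvs set"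
  assumes irr: "irreducible_conic_representation G T V \<tau>"
    and T: "topspace T = carrier G"
    and hom: "homeomorphism V V' p q"
    and p: "preserves_combinations V p"
    and sep: "separating_dual TYPE('w)"
  defines "\<sigma> \<equiv> \<lambda>g y. p (\<tau> g (q y))"
  shows "irreducible_conic_representation G T V' \<sigma>"
    and "conic_homomorphism G V \<tau> V' \<sigma> p"
    and "conic_homomorphism G V' \<sigma> V \<tau> q"
proof -
  have rep: "conic_representation G T V \<tau>"
    using irr by (simp add: irreducible_conic_representation_def)
  have cone: "a *\<^sub>R x + b *\<^sub>R y \<in> V" if "x \<in> V" "y \<in> V" "a \<ge> 0" "b \<ge> 0" for x y a b
    using rep that by (simp add: conic_representation_def linear_cone_def)
  have sepV: "separating_dual TYPE('v)"
    using rep by (simp add: conic_representation_def linear_cone_def)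
  obtain x0 where x0: "x0 \<in> V" "x0 \<noteq> 0"
    using rep by (auto simp: conic_representation_def)
  have pq: "\<And>x. x \<in> V \<Longrightarrow> q (p x) = x" "\<And>y. y \<in> V' \<Longrightarrow> p (q y) = y"
    "\<And>x. x \<in> V \<Longrightarrow> p x \<in> V'" "\<And>y. y \<in> V' \<Longrightarrow> q y \<in> V"
    and cp: "continuous_on V p" and cq: "continuous_on V' q"
    using hom by (auto simp: homeomorphism_def)
  have pc: "p (a *\<^sub>R x + b *\<^sub>R y) = a *\<^sub>R p x + b *\<^sub>R p y"
    if "x \<in> V" "y \<in> V" "a \<ge> 0" "b \<ge> 0" for x y a b
    using p that by (simp add: preserves_combinations_def)
  have cone': "a *\<^sub>R x + b *\<^sub>R y \<in> V'" if "x \<in> V'" "y \<in> V'" "a \<ge> 0" "b \<ge> 0" for x y a b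
    using pc[of "q x" "q y" a b] cone[of "q x" "q y" a b] that pq by metis
  have qc: "q (a *\<^sub>R x + b *\<^sub>R y) = a *\<^sub>R q x + b *\<^sub>R q y"
    if "x \<in> V'" "y \<in> V'" "a \<ge> 0" "b \<ge> 0" for x y a b
    using pc[of "q x" "q y" a b] cone[of "q x" "q y" a b] that pq by metis
  have zero: "0 \<in> V" "p 0 = 0" "0 \<in> V'" "q 0 = 0"
    using cone[of x0 x0 0 0] pc[of x0 x0 0 0] x0 pq(1,3)[of 0] by auto
  have nz: "p x \<noteq> 0" if "x \<in> V" "x \<noteq> 0" for x using that pq zero by metis
  have nz': "q x \<noteq> 0" if "x \<in> V'" "x \<noteq> 0" for x using that pq zero by metis
  have ct: "continuous_map (prod_topology T (top_of_set V)) (top_of_set V) (\<lambda>(g, x). \<tau> g x)"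
    using rep by (simp add: conic_representation_def)
  have tV: "\<tau> g x \<in> V" if "g \<in> carrier G" "x \<in> V" for g x
  proof -
    have "(\<lambda>(g, x). \<tau> g x) \<in> carrier G \<times> V \<rightarrow> V"
      using ct T by (simp add: continuous_map_def)
    from funcset_mem[OF this, of "(g, x)"] that show ?thesis by simp
  qed
  have tc: "\<tau> g (a *\<^sub>R x + b *\<^sub>R y) = a *\<^sub>R \<tau> g x + b *\<^sub>R \<tau> g y"
    if "g \<in> carrier G" "x \<in> V" "y \<in> V" "a \<ge> 0" "b \<ge> 0" for g x y a b
    using rep that by (simp add: conic_representation_def preserves_combinations_def)
  show hp: "conic_homomorphism G V \<tau> V' \<sigma> p"
    using pq cp p nz by (auto simp: conic_homomorphism_def \<sigma>_def)
  show hq: "conic_homomorphism G V' \<sigma> V \<tau> q"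
    using pq cq qc nz' tV by (auto simp: conic_homomorphism_def \<sigma>_def preserves_combinations_def)
  have rep': "conic_representation G T V' \<sigma>"
    unfolding conic_representation_def
  proof (intro conjI)
    show "linear_cone V'" using cone' sep by (auto simp: linear_cone_def)
    show "\<exists>x\<in>V'. x \<noteq> 0" using x0 pq nz by blast
    show "\<exists>S. section_of V' S \<and> compact S"
    proof -
      obtain S L where S: "compact S" "S = {x\<in>V. L x = 1}"
        and L: "continuous_on V L" "preserves_combinations V L"
          "\<forall>x\<in>V. 0 \<le> (L x::real)" "\<forall>x\<in>V - {0}. 0 < L x"
        using rep unfolding conic_representation_def section_of_def by blast
      have "continuous_on V' (\<lambda>y. L (q y))"
        using continuous_on_compose2[OF L(1) cq] pq by auto
      moreover have "preserves_combinations V' (\<lambda>y. L (q y))"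
        using L(2) pq qc by (simp add: preserves_combinations_def)
      moreover have "p ` S = {y \<in> V'. L (q y) = 1}"
        using S(2) pq by (auto simp: image_iff) (metis pq(2,4))
      moreover have "compact (p ` S)"
        using S cp by (intro compact_continuous_image) (auto intro: continuous_on_subset)
      moreover have "\<forall>y\<in>V'. 0 \<le> L (q y)" "\<forall>y\<in>V' - {0}. 0 < L (q y)"
        using L pq nz' by auto
      ultimately show ?thesis
        unfolding section_of_def by (intro exI[of _ "p ` S"] conjI exI[of _ "\<lambda>y. L (q y)"]) auto
    qed
    have "continuous_map (top_of_set V') (top_of_set V) q"
      using cq pq(4) by (auto simp: continuous_map_in_subtopology)
    from continuous_map_pairedI[OF continuous_map_fst continuous_map_compose[OF continuous_map_snd this]]
    have "continuous_map (prod_topology T (top_of_set V')) (prod_topology T (top_of_set V))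
        (\<lambda>z. (fst z, q (snd z)))"
      by (simp add: o_def)
    then have "continuous_map (prod_topology T (top_of_set V')) (top_of_set V)
        ((\<lambda>(g, x). \<tau> g x) \<circ> (\<lambda>z. (fst z, q (snd z))))"
      using ct by (rule continuous_map_compose)
    moreover have "continuous_map (top_of_set V) (top_of_set V') p"
      using cp pq by (auto simp: continuous_map_in_subtopology)
    ultimately have "continuous_map (prod_topology T (top_of_set V')) (top_of_set V')
        (p \<circ> ((\<lambda>(g, x). \<tau> g x) \<circ> (\<lambda>z. (fst z, q (snd z)))))"
      by (rule continuous_map_compose)
    then show "continuous_map (prod_topology T (top_of_set V')) (top_of_set V') (\<lambda>(g, x). \<sigma> g x)"
      by (simp add: o_def \<sigma>_def case_prod_unfold)
    show "\<forall>x\<in>V'. \<sigma> \<one>\<^bsub>G\<^esub> x = x"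
      using rep pq by (simp add: \<sigma>_def conic_representation_def)
    show "\<forall>g\<in>carrier G. \<forall>h\<in>carrier G. \<forall>x\<in>V'. \<sigma> (g \<otimes>\<^bsub>G\<^esub> h) x = \<sigma> g (\<sigma> h x)"
      using rep pq tV by (simp add: \<sigma>_def conic_representation_def)
    show "\<forall>g\<in>carrier G. preserves_combinations V' (\<sigma> g)"
      using tV tc pc qc pq by (simp add: \<sigma>_def preserves_combinations_def)
  qed
  show "irreducible_conic_representation G T V' \<sigma>"
    unfolding irreducible_conic_representation_def
  proof (intro conjI rep' allI impI, elim conjE)
    fix W
    assume W: "W \<subseteq> V'" "linear_cone W" "closedin (top_of_set V') W" "\<exists>x\<in>W. x \<noteq> 0"
      "\<forall>g\<in>carrier G. \<sigma> g ` W \<subseteq> W"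
    define U where "U = {x\<in>V. p x \<in> W}"
    have "closedin (top_of_set V) (V \<inter> p -` W)"
      using W(3) cp pq by (intro continuous_closedin_preimage_gen[of V p V']) auto
    moreover have "V \<inter> p -` W = U" by (auto simp: U_def)
    ultimately have "closedin (top_of_set V) U" by simp
    moreover have "linear_cone U"
      using W(2) cone pc sepV by (auto simp: linear_cone_def U_def)
    moreover have "\<exists>x\<in>U. x \<noteq> 0"
    proof -
      obtain y where y: "y \<in> W" "y \<noteq> 0" using W(4) by blast
      then have "y \<in> V'" using W(1) by blast
      then have "q y \<in> U" "q y \<noteq> 0" using y pq nz' by (auto simp: U_def)
      then show ?thesis by blast
    qed
    moreover have "\<forall>g\<in>carrier G. \<tau> g ` U \<subseteq> U"
    proof (intro ballI image_subsetI)
      fix g x assume g: "g \<in> carrier G" and x: "x \<in> U"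
      then have "\<sigma> g (p x) \<in> W" using W(5) by (auto simp: U_def)
      then show "\<tau> g x \<in> U" using g x pq(1) tV by (simp add: U_def \<sigma>_def)
    qed
    moreover have "U \<subseteq> V" by (auto simp: U_def)
    ultimately have "U = V"
      using irr unfolding irreducible_conic_representation_def by blast
    then show "W = V'"
    proof -
      have "y \<in> W" if y: "y \<in> V'" for y
      proof -
        have "q y \<in> U" using \<open>U = V\<close> pq(4)[OF y] by simp
        then show ?thesis using pq(2)[OF y] by (simp add: U_def)
      qed
      then show ?thesis using W(1) by blast
    qed
  qed
qed

lemma homeomorphism_into_real_family:
  fixes V :: "'v::real_tvs set" and p :: "'v \<Rightarrow> 'i real_family"
  assumes V: "linear_cone V" and S: "section_of V S" "compact S" "S \<noteq> {}"
    and p: "continuous_on V p" "preserves_combinations V p" "inj_on p V"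
  shows "homeomorphism V (p ` V) p (the_inv_into V p)"
proof -
  obtain L where L: "continuous_on V L" "preserves_combinations V L"
    "\<forall>x\<in>V. 0 \<le> (L x::real)" "\<forall>x\<in>V - {0}. 0 < L x" and SL: "S = {x\<in>V. L x = 1}"
    using S(1) unfolding section_of_def by blast
  have SV: "S \<subseteq> V" using SL by auto
  define B where "B n = (\<lambda>z. fst z *\<^sub>R snd z) ` ({0..n} \<times> S)" for n :: real
  have compB: "compact (B n)" for n
    unfolding B_def using S(2)
    by (intro compact_continuous_image continuous_on_scaleR_tvs compact_Times) (auto intro!: continuous_intros)
  have BV: "B n \<subseteq> V" for n
    using linear_cone_scaleR[OF V] SV by (auto simp: B_def)
  have inB: "x \<in> B n" if x: "x \<in> V" "L x \<le> n" for x n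
  proof (cases "x = 0")
    case True
    obtain s where "s \<in> S" using S(3) by auto
    moreover have "0 \<le> n" using x L(3) by fastforce
    ultimately show ?thesis
      unfolding B_def using True by (intro image_eqI[of _ _ "(0, s)"]) auto
  next
    case False
    with x L(4) have pos: "L x > 0" by auto
    then have "(1 / L x) *\<^sub>R x \<in> S"
      using SL x linear_cone_scaleR[OF V, of x] preserves_combinations_scaleR[OF L(2), of x] by auto
    with pos x show ?thesis
      unfolding B_def by (intro image_eqI[of _ _ "(L x, (1 / L x) *\<^sub>R x)"]) auto
  qed
  have p0: "p 0 = 0"
    using preserves_combinations_scaleR[OF p(2), of _ 0] S(3) SV by force
  have V0: "0 \<in> V"
    using linear_cone_scaleR[OF V, of _ 0] S(3) SV by force
  \<comment> \<open>finitely many coordinates dominate \<open>L\<close>\<close>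
  have cpi: "continuous_on V (\<lambda>x. coord (p x) i)" for i
    using p(1) by (simp add: continuous_on_real_family)
  have "\<exists>i. coord (p s) i \<noteq> 0" if "s \<in> S" for s
  proof (rule ccontr)
    assume "\<nexists>i. coord (p s) i \<noteq> 0"
    then have "p s = p 0" using p0 by (auto intro: real_family_eqI)
    then have "s = 0" using p(3) that SV V0 by (auto dest: inj_onD)
    then have "L s = 0"
      using preserves_combinations_scaleR[OF L(2) V0, of 0] by simp
    then show False using that SL by simp
  qed
  then obtain c where c: "\<And>s. s \<in> S \<Longrightarrow> coord (p s) (c s) \<noteq> 0" by metis
  have "\<exists>U. open U \<and> U \<inter> S = {x \<in> S. coord (p x) (c s) \<noteq> 0}" for s
  proof -
    have "continuous_on S (\<lambda>x. coord (p x) (c s))" using cpi SV by (rule continuous_on_subset)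
    then have "openin (top_of_set S) (S \<inter> (\<lambda>x. coord (p x) (c s)) -` (- {0}))"
      by (intro continuous_openin_preimage_gen) auto
    then obtain U where "open U" "S \<inter> (\<lambda>x. coord (p x) (c s)) -` (- {0}) = S \<inter> U"
      unfolding openin_open by blast
    then show ?thesis by (intro exI[of _ U]) auto
  qed
  then obtain U where U: "\<And>s. open (U s)" "\<And>s. U s \<inter> S = {x \<in> S. coord (p x) (c s) \<noteq> 0}" by metis
  have "S \<subseteq> (\<Union>s\<in>S. U s)" using U(2) c by blast
  then obtain D where D: "D \<subseteq> S" "finite D" "S \<subseteq> (\<Union>s\<in>D. U s)"
    using compactE_image[OF S(2), of S U] U(1) by metis
  define m where "m y = (\<Sum>s\<in>D. \<bar>coord y (c s)\<bar>)" for y :: "'i real_family"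
  have cm: "continuous_on UNIV m"
    unfolding m_def
    by (intro continuous_on_sum continuous_on_rabs continuous_on_coord_nth)
  have cmp: "continuous_on S (\<lambda>x. m (p x))"
    using continuous_on_compose2[OF cm continuous_on_subset[OF p(1) SV]] by auto
  have mpos: "m (p x) > 0" if x: "x \<in> S" for x
  proof -
    obtain s where s: "s \<in> D" "x \<in> U s" using D(3) x by blast
    then have "coord (p x) (c s) \<noteq> 0" using U(2) x by blast
    then show ?thesis
      unfolding m_def using D(2) s by (intro sum_pos2[of D s]) auto
  qed
  obtain s0 where s0: "s0 \<in> S" "\<And>x. x \<in> S \<Longrightarrow> m (p s0) \<le> m (p x)"
    using continuous_attains_inf[OF S(2,3) cmp] by auto
  define e where "e = m (p s0)"
  have e: "e > 0" using mpos s0 by (simp add: e_def)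
  have bound: "e * L x \<le> m (p x)" if x: "x \<in> V" for x
  proof (cases "x = 0")
    case True
    then show ?thesis
      using preserves_combinations_scaleR[OF L(2) V0, of 0] p0 by (simp add: m_def)
  next
    case False
    with x L(4) have pos: "L x > 0" by auto
    define s where "s = (1 / L x) *\<^sub>R x"
    have s: "s \<in> S"
      using SL x pos linear_cone_scaleR[OF V, of x] preserves_combinations_scaleR[OF L(2), of x]
      by (auto simp: s_def)
    have xs: "L x *\<^sub>R s = x" using pos by (simp add: s_def)
    have "p x = L x *\<^sub>R p s"
      using preserves_combinations_scaleR[OF p(2), of s "L x"] s SV pos by (auto simp: xs)
    then have "m (p x) = L x * m (p s)"
      using pos by (simp add: m_def abs_mult sum_distrib_left)
    moreover have "e \<le> m (p s)" using s0 s by (simp add: e_def)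
    ultimately show ?thesis using pos by (simp add: mult.commute)
  qed
  define q where "q = the_inv_into V p"
  have q: "\<And>x. x \<in> V \<Longrightarrow> q (p x) = x"
    unfolding q_def using p(3) by (rule the_inv_into_f_f)
  have "continuous_on (p ` V) q"
    unfolding continuous_on_eq_continuous_within
  proof
    fix y assume y: "y \<in> p ` V"
    define n where "n = (m y + 1) / e"
    have "q (p x) = x" if "x \<in> B n" for x
      using that BV[of n] q by blast
    then have "continuous_on (p ` B n) q"
      using continuous_on_subset[OF p(1) BV] compB by (intro continuous_on_inv) auto
    have op: "open (m -` {..< m y + 1})"
      using cm by (intro open_vimage) auto
    have sub: "p ` V \<inter> m -` {..< m y + 1} \<subseteq> p ` B n"
    proof
      fix z assume "z \<in> p ` V \<inter> m -` {..< m y + 1}"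
      then obtain x where x: "x \<in> V" "z = p x" "m (p x) < m y + 1" by auto
      then have "e * L x \<le> m y + 1" using bound[of x] by simp
      then have "L x \<le> n" using e by (simp add: n_def field_simps)
      then show "z \<in> p ` B n" using x inB by auto
    qed
    have "at y within p ` V = at y within (p ` V \<inter> m -` {..< m y + 1})"
      using op by (intro at_within_nhd[of y "m -` {..< m y + 1}"]) auto
    moreover have "continuous_on (p ` V \<inter> m -` {..< m y + 1}) q"
      using \<open>continuous_on (p ` B n) q\<close> sub by (rule continuous_on_subset)
    ultimately show "continuous (at y within p ` V) q"
      using y by (simp add: continuous_on_eq_continuous_within)
  qed
  then show ?thesis
    using p(1) q unfolding homeomorphism_def q_def[symmetric] by (auto simp: image_iff)
qed

lemma irreducible_conic_representation_copy:
  fixes G :: "('g, 'm) monoid_scheme" and V :: "'v::real_tvs set"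
  assumes G: "topological_group G T" and irr: "irreducible_conic_representation G T V \<tau>"
  shows "\<exists>(V' :: ('g \<Rightarrow> real) real_family set) \<sigma> p q.
           irreducible_conic_representation G T V' \<sigma> \<and> homeomorphism V V' p q \<and>
           conic_homomorphism G V \<tau> V' \<sigma> p \<and> conic_homomorphism G V' \<sigma> V \<tau> q"
proof -
  interpret group G using G by (simp add: topological_group_def)
  have T: "topspace T = carrier G" using G by (simp add: topological_group_def)
  have rep: "conic_representation G T V \<tau>"
    using irr by (simp add: irreducible_conic_representation_def)
  have V: "linear_cone V" using rep by (simp add: conic_representation_def)
  have ct: "continuous_map (prod_topology T (top_of_set V)) (top_of_set V) (\<lambda>(g, x). \<tau> g x)"
    and t1: "\<And>x. x \<in> V \<Longrightarrow> \<tau> \<one>\<^bsub>G\<^esub> x = x"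
    and tm: "\<And>g h x. \<lbrakk>g \<in> carrier G; h \<in> carrier G; x \<in> V\<rbrakk> \<Longrightarrow> \<tau> (g \<otimes>\<^bsub>G\<^esub> h) x = \<tau> g (\<tau> h x)"
    using rep by (simp_all add: conic_representation_def)
  have tV: "\<tau> g x \<in> V" if "g \<in> carrier G" "x \<in> V" for g x
  proof -
    have "(\<lambda>(g, x). \<tau> g x) \<in> carrier G \<times> V \<rightarrow> V"
      using ct T by (simp add: continuous_map_def)
    from funcset_mem[OF this, of "(g, x)"] that show ?thesis by simp
  qed
  have tc: "\<tau> g (a *\<^sub>R x + b *\<^sub>R y) = a *\<^sub>R \<tau> g x + b *\<^sub>R \<tau> g y"
    if "g \<in> carrier G" "x \<in> V" "y \<in> V" "a \<ge> 0" "b \<ge> 0" for g x y a b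
    using rep that by (simp add: conic_representation_def preserves_combinations_def)
  have ctg: "continuous_on V (\<tau> g)" if g: "g \<in> carrier G" for g
  proof -
    have "continuous_map (top_of_set V) (prod_topology T (top_of_set V)) (\<lambda>x. (g, x))"
      using g T by (intro continuous_map_pairedI) auto
    from continuous_map_compose[OF this ct] show ?thesis
      by (simp add: o_def continuous_map_in_subtopology)
  qed
  obtain v where v: "v \<in> V" "v \<noteq> 0" using rep by (auto simp: conic_representation_def)
  obtain S where S: "section_of V S" "compact S" using rep by (auto simp: conic_representation_def)
  have "S \<noteq> {}"
  proof -
    obtain L where L: "preserves_combinations V L" "0 < (L v::real)" "S = {x\<in>V. L x = 1}"
      using S(1) v unfolding section_of_def by blast
    then have "(1 / L v) *\<^sub>R v \<in> S"
      using v linear_cone_scaleR[OF V, of v] preserves_combinations_scaleR[OF L(1), of v] by auto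
    then show ?thesis by blast
  qed
  \<comment> \<open>functionals on \<open>V\<close> are determined by their values on the orbit of \<open>v\<close>\<close>
  define r where "r f = (\<lambda>g. if g \<in> carrier G then f (\<tau> g v) else 0)" for f :: "'v \<Rightarrow> real"
  have eq: "f x = f' x" if f: "continuous_functional f" "continuous_functional f'"
    and r: "r f = r f'" and x: "x \<in> V" for f f' x
  proof -
    define W where "W = {x \<in> V. \<forall>g\<in>carrier G. f (\<tau> g x) = f' (\<tau> g x)}"
    have lin: "linear f" "linear f'" and cf: "continuous_on UNIV f" "continuous_on UNIV f'"
      using f by (auto simp: continuous_functional_def)
    have "closedin (top_of_set V) {x \<in> V. f (\<tau> g x) - f' (\<tau> g x) = 0}" if "g \<in> carrier G" for g
      using continuous_on_compose2[OF cf(1) ctg[OF that]] continuous_on_compose2[OF cf(2) ctg[OF that]]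
      by (intro continuous_closedin_preimage_constant continuous_on_diff) auto
    then have "closedin (top_of_set V) (\<Inter>g\<in>carrier G. {x \<in> V. f (\<tau> g x) - f' (\<tau> g x) = 0})"
      using one_closed by (intro closedin_INT) auto
    moreover have "(\<Inter>g\<in>carrier G. {x \<in> V. f (\<tau> g x) - f' (\<tau> g x) = 0}) = W"
      using one_closed by (auto simp: W_def)
    ultimately have "closedin (top_of_set V) W" by simp
    moreover have "linear_cone W"
      using V lin tc by (auto simp: linear_cone_def W_def linear_add linear_scale)
    moreover have "v \<in> W"
      using v r by (auto simp: W_def r_def fun_eq_iff) metis
    moreover have "\<tau> h ` W \<subseteq> W" if h: "h \<in> carrier G" for h
    proof -
      have "f (\<tau> g (\<tau> h x)) = f' (\<tau> g (\<tau> h x))" if g: "g \<in> carrier G" and x: "x \<in> W" for g x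
      proof -
        have "f (\<tau> (g \<otimes>\<^bsub>G\<^esub> h) x) = f' (\<tau> (g \<otimes>\<^bsub>G\<^esub> h) x)" "x \<in> V"
          using x m_closed[OF g h] by (simp_all add: W_def)
        then show ?thesis using tm[OF g h] by simp
      qed
      then show ?thesis using h tV by (auto simp: W_def)
    qed
    moreover have "W \<subseteq> V" by (auto simp: W_def)
    ultimately have "W = V"
      using irr v(2) unfolding irreducible_conic_representation_def by blast
    then show "f x = f' x" using x one_closed t1[OF x] unfolding W_def by force
  qed
  define p where "p x = Family (\<lambda>h. if \<exists>f. continuous_functional f \<and> r f = h
      then (SOME f. continuous_functional f \<and> r f = h) x else 0)" for x
  have p_coord: "(\<forall>x. coord (p x) h = 0) \<or> (\<exists>f. continuous_functional f \<and> (\<forall>x. coord (p x) h = f x))" for h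
  proof (cases "\<exists>f. continuous_functional f \<and> r f = h")
    case True
    from someI_ex[OF True] True show ?thesis by (auto simp: p_def)
  next
    case False
    then show ?thesis by (auto simp: p_def)
  qed
  have p_r: "coord (p x) (r f) = f x" if f: "continuous_functional f" and x: "x \<in> V" for f x
  proof -
    have ex: "\<exists>f'. continuous_functional f' \<and> r f' = r f" using f by blast
    from someI_ex[OF ex] show ?thesis
      using eq[OF _ f _ x] ex by (auto simp: p_def)
  qed
  have "continuous_on V p"
      unfolding continuous_on_real_family
  proof
    fix h
    from p_coord[of h] show "continuous_on V (\<lambda>x. coord (p x) h)"
      by (auto simp: continuous_functional_def intro: continuous_on_subset)
  qed
  moreover have "preserves_combinations V p"
    unfolding preserves_combinations_def
  proof (intro ballI allI impI real_family_eqI)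
    fix x y and a b :: real and h
    from p_coord[of h] show "coord (p (a *\<^sub>R x + b *\<^sub>R y)) h = coord (a *\<^sub>R p x + b *\<^sub>R p y) h"
      by (auto simp: continuous_functional_def linear_add linear_scale)
  qed
  moreover have "inj_on p V"
  proof (rule inj_onI, rule ccontr)
    fix x y assume xy: "x \<in> V" "y \<in> V" "p x = p y" "x \<noteq> y"
    then have "x - y \<noteq> 0" by simp
    then obtain f where f: "continuous_functional f" "f (x - y) \<noteq> 0"
      using V unfolding linear_cone_def separating_dual_def by blast
    then have "f x \<noteq> f y" by (auto simp: continuous_functional_def linear_diff)
    then show False using p_r[OF f(1)] xy by metis
  qed
  ultimately have "homeomorphism V (p ` V) p (the_inv_into V p)" "preserves_combinations V p"
    using homeomorphism_into_real_family[OF V S \<open>S \<noteq> {}\<close>] by auto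
  with irreducible_conic_representation_transport[OF irr T this separating_dual_real_family]
  show ?thesis by blast
qed

theorem universal_irreducible_conic_representation_hom:
  fixes G :: "('g, 'm) monoid_scheme" and V :: "'v::real_tvs set" and W :: "'w::real_tvs set"
  assumes "topological_group G T"
    and "universal_irreducible_conic_representation G T V \<tau>"
    and "irreducible_conic_representation G T W \<sigma>"
  shows "\<exists>f. conic_homomorphism G V \<tau> W \<sigma> f"
proof -
  obtain W' :: "('g \<Rightarrow> real) real_family set" and \<sigma>' q
    where "irreducible_conic_representation G T W' \<sigma>'" "conic_homomorphism G W' \<sigma>' W \<sigma> q"
    using irreducible_conic_representation_copy[OF assms(1,3)] by metis
  with assms(2) show ?thesis
    unfolding universal_irreducible_conic_representation_def by (meson conic_homomorphism_comp)
qed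

end

(* Every character \<phi> acts on the ray [0, \<infinity>), giving an irreducible representation. A universal V would
   therefore carry positive functionals f and h, with h invariant and f scaled by \<phi>. The quotient f / h
   is bounded on V - {0}, since it is continuous on a compact section and homogeneous of degree 0. But
   along an orbit it is multiplied by powers of \<phi> g, which are unbounded as soon as \<phi> g > 1. *)
theory Submission
  imports Defs
begin

lemma separating_dual_real: "separating_dual TYPE(real)"
  unfolding separating_dual_def continuous_functional_def
  by (auto intro!: exI[of _ "\<lambda>x. x"] simp: linear_iff)

text \<open>Non-negative multiples of a single non-zero point already fill the ray, so a sub-cone
  containing such a point is everything. These rays are the targets on which universality is
  tested.\<close>

lemma irreducible_ray_representation:
  assumes G: "topological_group G T"
    and hom: "\<phi> \<in> hom G positive_reals"
    and cont: "continuous_map T (top_of_set {0<..}) \<phi>"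
  shows "irreducible_conic_representation G T {0::real..} (\<lambda>g x. \<phi> g * x)"
proof -
  interpret group G using G by (simp add: topological_group_def)
  have T: "topspace T = carrier G" using G by (simp add: topological_group_def)
  have pos: "\<phi> g > 0" if "g \<in> carrier G" for g
    using hom that by (auto simp: hom_def positive_reals_def)
  have mult: "\<phi> (g \<otimes>\<^bsub>G\<^esub> h) = \<phi> g * \<phi> h" if "g \<in> carrier G" "h \<in> carrier G" for g h
    using hom that by (auto simp: hom_def positive_reals_def)
  have one: "\<phi> \<one>\<^bsub>G\<^esub> = 1"
    \<comment> \<open>A positive real equal to its own square is 1.\<close>
    using mult[of "\<one>\<^bsub>G\<^esub>" "\<one>\<^bsub>G\<^esub>"] pos[of "\<one>\<^bsub>G\<^esub>"] by auto
  have "continuous_map (prod_topology T (top_of_set {0..})) euclidean (\<lambda>(g, x). \<phi> g * x)"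
  proof -
    have "continuous_map T euclidean \<phi>"
      using cont by (simp add: continuous_map_in_subtopology)
    then have "continuous_map (prod_topology T (top_of_set {0::real..})) euclidean (\<lambda>p. \<phi> (fst p))"
      using continuous_map_compose[OF continuous_map_fst] by (force simp: o_def)
    moreover have "continuous_map (prod_topology T (top_of_set {0::real..})) euclidean snd"
      using continuous_map_snd[of T "top_of_set {0::real..}"]
      by (simp add: continuous_map_in_subtopology)
    ultimately show ?thesis
      by (simp add: case_prod_unfold continuous_map_real_mult)
  qed
  then have "continuous_map (prod_topology T (top_of_set {0::real..})) (top_of_set {0..})
      (\<lambda>(g, x). \<phi> g * x)"
    using pos T by (auto simp: continuous_map_in_subtopology less_imp_le)
  moreover have "\<exists>S. section_of {0::real..} S \<and> compact S"
  proof (intro exI conjI)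
    \<comment> \<open>The functional is the identity, so its level set at 1 is a single
      point.\<close>
    show "section_of {0::real..} {1}"
      unfolding section_of_def preserves_combinations_def
      by (intro exI[of _ "\<lambda>x. x"]) auto
  qed simp
  moreover have "\<exists>x\<in>{0::real..}. x \<noteq> 0"
    by (rule bexI[of _ 1]) auto
  moreover have "linear_cone {0::real..}"
    by (simp add: linear_cone_def separating_dual_real)
  ultimately have "conic_representation G T {0::real..} (\<lambda>g x. \<phi> g * x)"
    unfolding conic_representation_def preserves_combinations_def
    by (simp add: one mult distrib_left mult.assoc mult.left_commute)
  moreover have "W = {0..}" if W: "W \<subseteq> {0..}" "linear_cone W" "x \<in> W" "x \<noteq> 0" for W and x :: real
  proof (intro equalityI subsetI)
    fix y :: real assume "y \<in> {0..}"
    moreover have "x > 0" using W by force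
    ultimately have "(y / x) *\<^sub>R x \<in> W" using W by (intro linear_cone_scaleR) auto
    then show "y \<in> W" using \<open>x \<noteq> 0\<close> by simp
  qed (use W in blast)
  ultimately show ?thesis
    unfolding irreducible_conic_representation_def by blast
qed

text \<open>Every non-zero point of \<open>V\<close> is a positive multiple of a point of
  \<open>S\<close>, and rescaling leaves \<open>f / h\<close> unchanged. A bound for the quotient on
  the compact \<open>S\<close> therefore holds on all of \<open>V - {0}\<close>.\<close>

lemma positive_functional_le:
  fixes V :: "'v::real_tvs set" and f h :: "'v \<Rightarrow> real"
  assumes V: "linear_cone V" and S: "section_of V S" "compact S"
    and f: "continuous_on V f" "preserves_combinations V f"
    and h: "continuous_on V h" "preserves_combinations V h" "\<And>x. x \<in> V \<Longrightarrow> x \<noteq> 0 \<Longrightarrow> h x > 0"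
  obtains C where "\<And>x. x \<in> V \<Longrightarrow> x \<noteq> 0 \<Longrightarrow> f x \<le> C * h x"
proof -
  obtain L where L: "preserves_combinations V L" "\<And>x. x \<in> V - {0} \<Longrightarrow> 0 < (L x :: real)"
    and SL: "S = {x\<in>V. L x = 1}"
    using S(1) unfolding section_of_def by blast
  \<comment> \<open>Points of \<open>S\<close> are non-zero because \<open>L 0 = 0\<close>, so the
    positivity of \<open>h\<close> applies to them.\<close>
  have hS: "h x > 0" if "x \<in> S" for x
    using that SL h(3) preserves_combinations_scaleR[OF L(1), of x 0] by force
  have "S \<subseteq> V" using SL by auto
  then have "continuous_on S (\<lambda>x. f x / h x)"
    using f(1) h(1) hS by (intro continuous_on_divide) (force intro: continuous_on_subset)+
  then have "bounded ((\<lambda>x. f x / h x) ` S)"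
    using S(2) compact_continuous_image compact_imp_bounded by blast
  then obtain C where C: "\<And>s. s \<in> S \<Longrightarrow> f s / h s \<le> C"
    unfolding bounded_iff by (metis abs_le_D1 image_eqI real_norm_def)
  have "f x \<le> C * h x" if x: "x \<in> V" "x \<noteq> 0" for x
  proof -
    have Lx: "L x > 0" using L(2) x by simp
    define s where "s = (1 / L x) *\<^sub>R x"
    have s: "s \<in> S"
      using SL x Lx linear_cone_scaleR[OF V, of x] preserves_combinations_scaleR[OF L(1), of x]
      by (auto simp: s_def)
    \<comment> \<open>The common factor \<open>1 / L x\<close> cancels in the quotient
      \<open>f s / h s\<close>.\<close>
    have "f s = f x / L x" "h s = h x / L x"
      using x Lx preserves_combinations_scaleR[OF f(2)] preserves_combinations_scaleR[OF h(2)]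
      by (auto simp: s_def)
    with C[OF s] show ?thesis using h(3)[OF x] Lx by (simp add: field_simps)
  qed
  then show thesis by (rule that)
qed

text \<open>The values at \<open>g\<close> and at its inverse multiply to 1, so if the first is
  below 1 the second exceeds 1.\<close>

lemma exists_character_gt_1:
  assumes "group G" "\<phi> \<in> hom G positive_reals" "g \<in> carrier G" "\<phi> g \<noteq> 1"
  obtains k where "k \<in> carrier G" "\<phi> k > 1"
proof -
  interpret group G by fact
  have pos: "\<phi> g > 0" if "g \<in> carrier G" for g
    using assms(2) that by (auto simp: hom_def positive_reals_def)
  have mult: "\<phi> (g \<otimes>\<^bsub>G\<^esub> h) = \<phi> g * \<phi> h" if "g \<in> carrier G" "h \<in> carrier G" for g h
    using assms(2) that by (auto simp: hom_def positive_reals_def)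
  have "\<phi> \<one>\<^bsub>G\<^esub> = 1"
    using mult[of "\<one>\<^bsub>G\<^esub>" "\<one>\<^bsub>G\<^esub>"] pos[of "\<one>\<^bsub>G\<^esub>"] by auto
  then have inv: "\<phi> g * \<phi> (inv\<^bsub>G\<^esub> g) = 1"
    using mult[of g "inv\<^bsub>G\<^esub> g"] assms(3) by simp
  show thesis
  proof (cases "\<phi> g > 1")
    case True
    then show thesis using that assms(3) by blast
  next
    case False
    with assms(4) have "\<phi> g < 1" by simp
    then have "\<phi> g * \<phi> (inv\<^bsub>G\<^esub> g) < 1 * \<phi> (inv\<^bsub>G\<^esub> g)"
      using assms(3) by (intro mult_strict_right_mono pos) auto
    with inv have "\<phi> (inv\<^bsub>G\<^esub> g) > 1" by simp
    then show thesis using that assms(3) by blast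
  qed
qed

theorem corollary24:
  fixes G :: "('g, 'm) monoid_scheme" and T :: "'g topology" and \<phi> :: "'g \<Rightarrow> real"
  assumes "topological_group G T"
    and "\<phi> \<in> hom G positive_reals"
    and "continuous_map T (top_of_set {0<..}) \<phi>"
    and "\<exists>g\<in>carrier G. \<phi> g \<noteq> 1"
  shows "\<not> (\<exists>(V :: 'v::real_tvs set) \<tau>. universal_irreducible_conic_representation G T V \<tau>)"
proof
  assume "\<exists>(V :: 'v set) \<tau>. universal_irreducible_conic_representation G T V \<tau>"
  then obtain V :: "'v set" and \<tau> where univ: "universal_irreducible_conic_representation G T V \<tau>"
    by blast
  have G: "group G" and T: "topspace T = carrier G"
    using assms(1) by (simp_all add: topological_group_def)
  obtain g where g: "g \<in> carrier G" "\<phi> g > 1"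
    using assms(2,4) exists_character_gt_1[OF G] by metis
  have rep: "conic_representation G T V \<tau>"
    using univ
    by (simp add: universal_irreducible_conic_representation_def irreducible_conic_representation_def)
  then obtain S v where V: "linear_cone V" and S: "section_of V S" "compact S" and v: "v \<in> V" "v \<noteq> 0"
    and ct: "continuous_map (prod_topology T (top_of_set V)) (top_of_set V) (\<lambda>(g, x). \<tau> g x)"
    unfolding conic_representation_def by blast
  \<comment> \<open>Invariance of \<open>V\<close> is encoded only in the codomain of the continuous
    action map.\<close>
  have \<tau>V: "\<tau> g x \<in> V" if "x \<in> V" for x
  proof -
    have "(\<lambda>(g, x). \<tau> g x) \<in> carrier G \<times> V \<rightarrow> V"
      using ct T by (simp add: continuous_map_def)
    from funcset_mem[OF this, of "(g, x)"] that g show ?thesis by simp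
  qed
  \<comment> \<open>The universal property is used in its form for arbitrary target spaces, since
    the ray lies in \<open>real\<close>.\<close>
  obtain f where f: "conic_homomorphism G V \<tau> {0::real..} (\<lambda>g x. \<phi> g * x) f"
    using universal_irreducible_conic_representation_hom[OF assms(1) univ
        irreducible_ray_representation[OF assms(1-3)]] by blast
  \<comment> \<open>The constant character makes the action on the ray trivial, so the resulting
    \<open>h\<close> is constant along orbits.\<close>
  have "(\<lambda>_. 1) \<in> hom G positive_reals" "continuous_map T (top_of_set {0<..}) (\<lambda>_. 1::real)"
    by (simp_all add: hom_def positive_reals_def)
  from universal_irreducible_conic_representation_hom[OF assms(1) univ
      irreducible_ray_representation[OF assms(1) this]]
  obtain h where h: "conic_homomorphism G V \<tau> {0::real..} (\<lambda>g x. 1 * x) h"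
    by blast
  \<comment> \<open>Values lie in the ray and do not vanish off 0, hence are strictly
    positive.\<close>
  have fpos: "f x > 0" and hpos: "h x > 0" if "x \<in> V" "x \<noteq> 0" for x
    using f h that unfolding conic_homomorphism_def by (force simp: Pi_iff order_less_le)+
  have "continuous_on V f" "preserves_combinations V f" "continuous_on V h" "preserves_combinations V h"
    using f h by (simp_all add: conic_homomorphism_def)
  then obtain C where C: "\<And>x. x \<in> V \<Longrightarrow> x \<noteq> 0 \<Longrightarrow> f x \<le> C * h x"
    using positive_functional_le[OF V S, of f h] hpos by metis
  have h0: "h 0 = 0"
    using preserves_combinations_scaleR[of V h v 0] h v by (simp add: conic_homomorphism_def)
  have orbit: "(\<tau> g ^^ n) v \<in> V \<and> h ((\<tau> g ^^ n) v) = h v \<and> f ((\<tau> g ^^ n) v) = \<phi> g ^ n * f v" for n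
    using f h g \<tau>V v by (induction n) (auto simp: conic_homomorphism_def)
  have bound: "\<phi> g ^ n * f v \<le> C * h v" for n
    \<comment> \<open>The bound applies because the orbit avoids 0: \<open>h\<close> keeps the value
      \<open>h v > 0\<close> along it, while \<open>h 0 = 0\<close>.\<close>
    using C[of "(\<tau> g ^^ n) v"] orbit[of n] hpos[OF v] h0 by force
  \<comment> \<open>Since \<open>\<phi> g > 1\<close>, its powers eventually exceed the fixed ratio
    that \<open>bound\<close> imposes on all of them.\<close>
  obtain n where "C * h v / f v < \<phi> g ^ n"
    using real_arch_pow[OF g(2)] by blast
  with bound[of n] fpos[OF v] show False by (simp add: field_simps)
qed

end
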